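(* Let $(M,\omega)$ be a pre-$n$-plectic manifold, $H\in\Omega^{n-1}_{\mathrm{Ham}}(M)$, and let $(f)=\{f_i\}_{1\le i\le n}$ be a co-momentum map for a multisymplectic infinitesimal action $\mathfrak g\to\mathfrak X(M,\omega)$, $x\mapsto v_x$, which is strictly $H$-preserving, i.e. $\mathcal L_{v_x}H=0$ for all $x\in\mathfrak g$. Let $v_H$ be any Hamiltonian vector field of $H$ and let $p\in Z_k(\mathfrak g)$, $1\le k\le n$. Then $f_k(p)\in\Omega^{n-k}(M)$ is globally conserved by $v_H$, i.e. $\mathcal L_{v_H}f_k(p)$ is an exact form.
   Context: A pre-$n$-plectic manifold ($n\ge 1$) is a smooth manifold $M$ with a closed form $\omega\in\Omega^{n+1}(M)$. A form $\alpha\in\Omega^{n-1}(M)$ is Hamiltonian if there is a vector field $v_\alpha$ (a Hamiltonian vector field for $\alpha$; not necessarily unique) with $d\alpha=-\iota_{v_\alpha}\omega$; $\Omega^{n-1}_{\mathrm{Ham}}(M)$ is the set of Hamiltonian $(n-1)$-forms. Contraction with multivector fields: $\iota(v_1\wedge\dots\wedge v_k)=\iota_{v_k}\cdots\iota_{v_1}$. $\mathfrak g$ is a real Lie algebra; a multisymplectic infinitesimal action is a Lie algebra homomorphism $x\mapsto v_x$ from $\mathfrak g$ to $\mathfrak X(M,\omega)=\{X\in\mathfrak X(M):\mathcal L_X\omega=0\}$. For $p=x_1\wedge\dots\wedge x_k$ put $v_p=v_{x_1}\wedge\dots\wedge v_{x_k}$, extended linearly to $p\in\Lambda^k\mathfrak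 g$. Lie algebra homology differential: $\partial_k:\Lambda^k\mathfrak g\to\Lambda^{k-1}\mathfrak g$, $\partial(x_1\wedge\dots\wedge x_k)=\sum_{1\le i<j\le k}(-1)^{i+j}[x_i,x_j]\wedge x_1\wedge\dots\wedge\hat x_i\wedge\dots\wedge\hat x_j\wedge\dots\wedge x_k$; $Z_k(\mathfrak g)=\ker\partial_k$. Let $\varsigma(k)=-(-1)^{k(k+1)/2}$. A (homotopy) co-momentum map is a collection of linear maps $f_i:\Lambda^i\mathfrak g\to\Omega^{n-i}(M)$, $1\le i\le n$, with $f_1(\mathfrak g)\subset\Omega^{n-1}_{\mathrm{Ham}}(M)$, $d(f_1(x))=-\iota_{v_x}\omega$ for all $x\in\mathfrak g$, and, setting $f_0=f_{n+1}=0$, $-f_{k-1}(\partial p)=df_k(p)+\varsigma(k)\iota(v_p)\omega$ for all $1\le k\le n+1$, $p\in\Lambda^k\mathfrak g$. *)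

theory Defs
  imports
    "HOL-Analysis.Analysis"
    "HOL-Analysis.Finite_Function_Topology"
    "HOL-Library.Function_Algebras"
begin

section \<open>Preliminaries\<close>

text \<open>Together with \<open>Function_Algebras\<close> this makes all of \<open>+\<close>, \<open>-\<close>, \<open>*\<close>, \<open>0\<close>, \<open>1\<close> and \<open>*\<^sub>R\<close>
  pointwise on functions.\<close>

instantiation "fun" :: (type, real_vector) real_vector
begin

definition scaleR_fun_def: "c *\<^sub>R f = (\<lambda>x. c *\<^sub>R f x)"

instance
  by standard (simp_all add: scaleR_fun_def fun_eq_iff algebra_simps)

end

lemma scaleR_fun_apply [simp]: "(c *\<^sub>R f) x = c *\<^sub>R f x"
  by (simp add: scaleR_fun_def)

definition delete_nth :: "nat \<Rightarrow> 'a list \<Rightarrow> 'a list" where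
  "delete_nth i xs = take i xs @ drop (Suc i) xs"

definition linear_on_subspace :: "'a::real_vector set \<Rightarrow> ('a \<Rightarrow> 'b::real_vector) \<Rightarrow> bool" where
  "linear_on_subspace S F \<longleftrightarrow>
     (\<forall>x\<in>S. \<forall>y\<in>S. F (x + y) = F x + F y) \<and> (\<forall>c. \<forall>x\<in>S. F (c *\<^sub>R x) = c *\<^sub>R F x)"


section \<open>Smooth manifolds\<close>

subsection \<open>Smooth functions on open subsets of Euclidean space\<close>

text \<open>Points of \<open>d\<close>-dimensional space are the sequences vanishing from index \<open>d\<close> on, as in
  \<open>Euclidean_space d\<close>; the dimension \<open>0\<close> is thus included.\<close>

definition partial_deriv :: "nat \<Rightarrow> ((nat \<Rightarrow> real) \<Rightarrow> real) \<Rightarrow> (nat \<Rightarrow> real) \<Rightarrow> real" where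
  "partial_deriv i f x = deriv (\<lambda>t. f (x(i := t))) (x i)"

primrec Ck_on :: "nat \<Rightarrow> nat \<Rightarrow> (nat \<Rightarrow> real) set \<Rightarrow> ((nat \<Rightarrow> real) \<Rightarrow> real) \<Rightarrow> bool" where
  "Ck_on d 0 U f \<longleftrightarrow> continuous_on U f"
| "Ck_on d (Suc k) U f \<longleftrightarrow> continuous_on U f \<and>
     (\<forall>i<d. (\<forall>x\<in>U. (\<lambda>t. f (x(i := t))) differentiable (at (x i))) \<and> Ck_on d k U (partial_deriv i f))"

definition smooth_on :: "nat \<Rightarrow> (nat \<Rightarrow> real) set \<Rightarrow> ((nat \<Rightarrow> real) \<Rightarrow> real) \<Rightarrow> bool" where
  "smooth_on d U f \<longleftrightarrow> (\<forall>k. Ck_on d k U f)"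

subsection \<open>Manifolds\<close>

text \<open>The underlying set of a manifold is the whole type \<open>'m\<close>. A chart is a pair of its domain
  and its coordinate map; the values of the latter off the domain are irrelevant.\<close>

type_synonym 'm chart = "'m set \<times> ('m \<Rightarrow> nat \<Rightarrow> real)"

record 'm manifold =
  dim :: nat
  atlas :: "'m chart set"

definition is_chart :: "nat \<Rightarrow> 'm::topological_space chart \<Rightarrow> bool" where
  "is_chart d = (\<lambda>(U, \<phi>). open U \<and> openin (Euclidean_space d) (\<phi> ` U) \<and>
     homeomorphic_map (top_of_set U) (subtopology (Euclidean_space d) (\<phi> ` U)) \<phi>)"

definition smooth_manifold :: "'m::{t2_space, second_countable_topology} manifold \<Rightarrow> bool" where
  "smooth_manifold M \<longleftrightarrow>
     (\<forall>c\<in>atlas M. is_chart (dim M) c) \<and> (\<Union>(U, \<phi>)\<in>atlas M. U) = UNIV \<and>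
     (\<forall>(U, \<phi>)\<in>atlas M. \<forall>(V, \<psi>)\<in>atlas M. \<forall>i<dim M.
        smooth_on (dim M) (\<phi> ` (U \<inter> V)) (\<lambda>x. \<psi> (inv_into U \<phi> x) i))"

definition smooth_functions :: "'m manifold \<Rightarrow> ('m \<Rightarrow> real) set" where
  "smooth_functions M =
     {f. \<forall>(U, \<phi>)\<in>atlas M. smooth_on (dim M) (\<phi> ` U) (f \<circ> inv_into U \<phi>)}"

subsection \<open>Vector fields and differential forms\<close>

text \<open>As in Helgason's \<^emph>\<open>Differential Geometry, Lie Groups, and Symmetric Spaces\<close>, Chapter I,
  vector fields are the derivations of the algebra of smooth functions, and differential
  \<open>k\<close>-forms are the alternating maps of \<open>k\<close> vector fields to smooth functions that are
  multilinear over the smooth functions. So that equality of such maps is equality in HOL,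
  they vanish outside their domains: a vector field maps non-smooth functions to \<open>0\<close>, and a
  \<open>k\<close>-form maps to \<open>0\<close> every list that does not consist of exactly \<open>k\<close> vector fields.\<close>

type_synonym 'm vfield = "('m \<Rightarrow> real) \<Rightarrow> 'm \<Rightarrow> real"
type_synonym 'm form = "'m vfield list \<Rightarrow> 'm \<Rightarrow> real"

definition vector_fields :: "'m manifold \<Rightarrow> 'm vfield set" where
  "vector_fields M = {X.
     (\<forall>f\<in>smooth_functions M. X f \<in> smooth_functions M) \<and>
     linear_on_subspace (smooth_functions M) X \<and>
     (\<forall>f\<in>smooth_functions M. \<forall>g\<in>smooth_functions M. X (f * g) = f * X g + g * X f) \<and>
     (\<forall>f. f \<notin> smooth_functions M \<longrightarrow> X f = 0)}"

definition vf_mult :: "('m \<Rightarrow> real) \<Rightarrow> 'm vfield \<Rightarrow> 'm vfield" where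
  "vf_mult g X = (\<lambda>f. g * X f)"

definition vf_bracket :: "'m vfield \<Rightarrow> 'm vfield \<Rightarrow> 'm vfield" where
  "vf_bracket X Y = (\<lambda>f. X (Y f) - Y (X f))"

definition forms :: "'m manifold \<Rightarrow> nat \<Rightarrow> 'm form set" where
  "forms M k = {\<alpha>.
     (\<forall>Xs. set Xs \<subseteq> vector_fields M \<and> length Xs = k \<longrightarrow> \<alpha> Xs \<in> smooth_functions M) \<and>
     (\<forall>Xs. \<not> (set Xs \<subseteq> vector_fields M \<and> length Xs = k) \<longrightarrow> \<alpha> Xs = 0) \<and>
     (\<forall>Xs Ys. \<forall>X\<in>vector_fields M. \<forall>Y\<in>vector_fields M. set (Xs @ Ys) \<subseteq> vector_fields M \<longrightarrow>
        \<alpha> (Xs @ (X + Y) # Ys) = \<alpha> (Xs @ X # Ys) + \<alpha> (Xs @ Y # Ys)) \<and>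
     (\<forall>Xs Ys. \<forall>g\<in>smooth_functions M. \<forall>X\<in>vector_fields M. set (Xs @ Ys) \<subseteq> vector_fields M \<longrightarrow>
        \<alpha> (Xs @ vf_mult g X # Ys) = g * \<alpha> (Xs @ X # Ys)) \<and>
     (\<forall>Xs. \<not> distinct Xs \<longrightarrow> \<alpha> Xs = 0)}"

definition contract :: "'m vfield \<Rightarrow> 'm form \<Rightarrow> 'm form" where
  "contract X \<alpha> = (\<lambda>Xs. \<alpha> (X # Xs))"

text \<open>The invariant formula for \<open>d\<close>, without Helgason's normalising factor \<open>1/(k + 1)\<close>; in
  coordinates this is the usual \<open>d(f dx\<^sub>I) = df \<and> dx\<^sub>I\<close>.\<close>

definition ext_deriv :: "'m manifold \<Rightarrow> 'm form \<Rightarrow> 'm form" where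
  "ext_deriv M \<alpha> = (\<lambda>Xs. if set Xs \<subseteq> vector_fields M then
       (\<Sum>i<length Xs. (- 1) ^ i *\<^sub>R (Xs ! i) (\<alpha> (delete_nth i Xs)))
     + (\<Sum>j<length Xs. \<Sum>i<j. (- 1) ^ (i + j) *\<^sub>R
          \<alpha> (vf_bracket (Xs ! i) (Xs ! j) # delete_nth i (delete_nth j Xs)))
     else 0)"

definition lie_deriv :: "'m manifold \<Rightarrow> 'm vfield \<Rightarrow> 'm form \<Rightarrow> 'm form" where
  "lie_deriv M X \<alpha> = (\<lambda>Ys. if set Ys \<subseteq> vector_fields M then
       X (\<alpha> Ys) - (\<Sum>i<length Ys. \<alpha> (Ys[i := vf_bracket X (Ys ! i)]))
     else 0)"

definition closed_form :: "'m manifold \<Rightarrow> 'm form \<Rightarrow> bool" where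
  "closed_form M \<alpha> \<longleftrightarrow> ext_deriv M \<alpha> = 0"

text \<open>There are no forms of degree \<open>-1\<close>, so only \<open>0\<close> is exact in degree \<open>0\<close>.\<close>

definition exact_form :: "'m manifold \<Rightarrow> nat \<Rightarrow> 'm form \<Rightarrow> bool" where
  "exact_form M k \<beta> \<longleftrightarrow>
     (case k of 0 \<Rightarrow> \<beta> = 0 | Suc j \<Rightarrow> \<exists>\<gamma>\<in>forms M j. \<beta> = ext_deriv M \<gamma>)"


section \<open>The exterior algebra of a real vector space\<close>

text \<open>The free vector space on the lists over \<open>'g\<close>, modulo the relations that make the class of
  \<open>[x\<^sub>1, \<dots>, x\<^sub>k]\<close> multilinear and alternating in its entries.\<close>

definition wedge_relations :: "('g::real_vector list \<Rightarrow>\<^sub>0 real) set" where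
  "wedge_relations =
     {Poly_Mapping.single (xs @ (a + b) # ys) 1
        - Poly_Mapping.single (xs @ a # ys) 1 - Poly_Mapping.single (xs @ b # ys) 1 | xs a b ys. True}
   \<union> {Poly_Mapping.single (xs @ (c *\<^sub>R a) # ys) 1 - Poly_Mapping.single (xs @ a # ys) c | xs c a ys. True}
   \<union> {Poly_Mapping.single xs 1 | xs. \<not> distinct xs}"

definition wedge_rel :: "('g::real_vector list \<Rightarrow>\<^sub>0 real) \<Rightarrow> ('g list \<Rightarrow>\<^sub>0 real) \<Rightarrow> bool" where
  "wedge_rel p q \<longleftrightarrow> p - q \<in> span wedge_relations"

lemma equivp_wedge_rel: "equivp wedge_rel"
proof (rule equivpI)
  show "reflp wedge_rel"
    by (simp add: reflp_def wedge_rel_def span_zero)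
  show "symp wedge_rel"
    unfolding symp_def wedge_rel_def by (metis minus_diff_eq span_neg)
  show "transp wedge_rel"
    unfolding transp_def wedge_rel_def using span_add by fastforce
qed

quotient_type (overloaded) 'g exterior = "'g::real_vector list \<Rightarrow>\<^sub>0 real" / wedge_rel
  by (rule equivp_wedge_rel)

instantiation exterior :: (real_vector) real_vector
begin

lift_definition zero_exterior :: "'a exterior" is 0 .

lift_definition plus_exterior :: "'a exterior \<Rightarrow> 'a exterior \<Rightarrow> 'a exterior" is "(+)"
  unfolding wedge_rel_def by (simp only: add_diff_add span_add)

lift_definition minus_exterior :: "'a exterior \<Rightarrow> 'a exterior \<Rightarrow> 'a exterior" is "(-)"
proof -
  fix p p' q q' :: "'a list \<Rightarrow>\<^sub>0 real"
  assume "wedge_rel p p'" "wedge_rel q q'"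
  moreover have "(p - q) - (p' - q') = (p - p') - (q - q')"
    by (simp add: algebra_simps)
  ultimately show "wedge_rel (p - q) (p' - q')"
    unfolding wedge_rel_def by (simp only: span_diff)
qed

lift_definition uminus_exterior :: "'a exterior \<Rightarrow> 'a exterior" is uminus
  unfolding wedge_rel_def by (simp only: minus_diff_minus span_neg)

lift_definition scaleR_exterior :: "real \<Rightarrow> 'a exterior \<Rightarrow> 'a exterior" is scaleR
  unfolding wedge_rel_def by (simp only: scaleR_diff_right [symmetric] span_scale)

instance
  by (standard; transfer)
    (simp_all add: wedge_rel_def span_zero algebra_simps)

end

lift_definition wedge :: "'g::real_vector list \<Rightarrow> 'g exterior" is "\<lambda>xs. Poly_Mapping.single xs 1" .

definition ext_power :: "nat \<Rightarrow> 'g::real_vector exterior set" where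
  "ext_power k = span {wedge xs | xs. length xs = k}"

definition alt_multilinear :: "('g::real_vector list \<Rightarrow> 'b::real_vector) \<Rightarrow> bool" where
  "alt_multilinear F \<longleftrightarrow>
     (\<forall>xs a b ys. F (xs @ (a + b) # ys) = F (xs @ a # ys) + F (xs @ b # ys)) \<and>
     (\<forall>xs c a ys. F (xs @ (c *\<^sub>R a) # ys) = c *\<^sub>R F (xs @ a # ys)) \<and>
     (\<forall>xs. \<not> distinct xs \<longrightarrow> F xs = 0)"

definition lin_extend :: "('a \<Rightarrow> 'b::real_vector) \<Rightarrow> ('a \<Rightarrow>\<^sub>0 real) \<Rightarrow> 'b" where
  "lin_extend F r = (\<Sum>x\<in>Poly_Mapping.keys r. Poly_Mapping.lookup r x *\<^sub>R F x)"

text \<open>The linear extension along \<open>wedge\<close>: of use only for alternating multilinear \<open>F\<close>, where it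
  does not depend on the representative (\<open>linear_ext_lift\<close> and \<open>ext_lift_wedge\<close> below).\<close>

definition ext_lift :: "('g::real_vector list \<Rightarrow> 'b::real_vector) \<Rightarrow> 'g exterior \<Rightarrow> 'b" where
  "ext_lift F p = lin_extend F (rep_exterior p)"

lemma lin_extend_superset:
  assumes "finite A" "Poly_Mapping.keys r \<subseteq> A"
  shows "lin_extend F r = (\<Sum>x\<in>A. Poly_Mapping.lookup r x *\<^sub>R F x)"
  unfolding lin_extend_def
  by (rule sum.mono_neutral_left) (use assms in \<open>auto simp: in_keys_iff\<close>)

lemma lookup_scaleR: "Poly_Mapping.lookup (c *\<^sub>R r) x = c *\<^sub>R Poly_Mapping.lookup r x"
  for r :: "'a \<Rightarrow>\<^sub>0 'b::real_vector"
proof -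
  have "finite {x. c *\<^sub>R Poly_Mapping.lookup r x \<noteq> 0}"
    by (rule finite_subset [OF _ finite_lookup [of r]]) auto
  then show ?thesis
    by (simp add: scaleR_poly_mapping_def)
qed

lemma linear_lin_extend: "linear (lin_extend F)"
proof (rule linearI)
  fix p q :: "'a \<Rightarrow>\<^sub>0 real"
  have "lin_extend F (p + q) =
      (\<Sum>x\<in>Poly_Mapping.keys p \<union> Poly_Mapping.keys q. Poly_Mapping.lookup (p + q) x *\<^sub>R F x)"
    by (rule lin_extend_superset) (auto simp: keys_add)
  then show "lin_extend F (p + q) = lin_extend F p + lin_extend F q"
    by (simp add: lookup_add scaleR_left_distrib sum.distrib
        lin_extend_superset [of "Poly_Mapping.keys p \<union> Poly_Mapping.keys q" p]
        lin_extend_superset [of "Poly_Mapping.keys p \<union> Poly_Mapping.keys q" q])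
next
  fix c :: real and p :: "'a \<Rightarrow>\<^sub>0 real"
  have "lin_extend F (c *\<^sub>R p) = (\<Sum>x\<in>Poly_Mapping.keys p. Poly_Mapping.lookup (c *\<^sub>R p) x *\<^sub>R F x)"
    by (rule lin_extend_superset) (auto simp: in_keys_iff lookup_scaleR)
  then show "lin_extend F (c *\<^sub>R p) = c *\<^sub>R lin_extend F p"
    by (simp add: lookup_scaleR lin_extend_def scaleR_sum_right)
qed

lemma lin_extend_single: "lin_extend F (Poly_Mapping.single x c) = c *\<^sub>R F x"
  by (subst lin_extend_superset [of "{x}"]) (auto)

lemma lin_extend_relations:
  assumes F: "alt_multilinear F" and r: "r \<in> span wedge_relations"
  shows "lin_extend F r = 0"
proof -
  have "lin_extend F s = 0" if "s \<in> wedge_relations" for s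
    using that F unfolding wedge_relations_def alt_multilinear_def
    by (auto simp: linear_diff [OF linear_lin_extend] lin_extend_single)
  then show ?thesis
    using linear_eq_0_on_span [OF linear_lin_extend] r by blast
qed

lemma ext_lift_abs:
  assumes "alt_multilinear F"
  shows "ext_lift F (abs_exterior r) = lin_extend F r"
proof -
  have "wedge_rel (rep_exterior (abs_exterior r)) r"
    by (rule rep_abs_rsp_left [OF Quotient3_exterior]) (simp add: wedge_rel_def span_zero)
  then have "lin_extend F (rep_exterior (abs_exterior r) - r) = 0"
    unfolding wedge_rel_def by (rule lin_extend_relations [OF assms])
  then show ?thesis
    by (simp add: linear_diff [OF linear_lin_extend] ext_lift_def)
qed

lemma ext_lift_wedge: "alt_multilinear F \<Longrightarrow> ext_lift F (wedge xs) = F xs"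
  by (simp add: wedge.abs_eq ext_lift_abs lin_extend_single)

lemma linear_ext_lift:
  assumes "alt_multilinear F"
  shows "linear (ext_lift F)"
proof (rule linearI)
  fix p q :: "'a exterior"
  obtain r s where "p = abs_exterior r" "q = abs_exterior s"
    by (metis Quotient3_abs_rep Quotient3_exterior)
  then show "ext_lift F (p + q) = ext_lift F p + ext_lift F q"
    by (simp add: plus_exterior.abs_eq ext_lift_abs [OF assms] linear_add [OF linear_lin_extend])
next
  fix c :: real and p :: "'a exterior"
  obtain r where "p = abs_exterior r"
    by (metis Quotient3_abs_rep Quotient3_exterior)
  then show "ext_lift F (c *\<^sub>R p) = c *\<^sub>R ext_lift F p"
    by (simp add: scaleR_exterior.abs_eq ext_lift_abs [OF assms] linear_scale [OF linear_lin_extend])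
qed

lemma alt_multilinear_wedge: "alt_multilinear wedge"
  unfolding alt_multilinear_def
proof (intro conjI allI impI)
  fix xs ys :: "'a list" and a b
  show "wedge (xs @ (a + b) # ys) = wedge (xs @ a # ys) + wedge (xs @ b # ys)"
  proof transfer
    fix xs ys :: "'a list" and a b
    have "Poly_Mapping.single (xs @ (a + b) # ys) (1::real)
        - Poly_Mapping.single (xs @ a # ys) 1 - Poly_Mapping.single (xs @ b # ys) 1 \<in> wedge_relations"
      unfolding wedge_relations_def by blast
    then show "wedge_rel (Poly_Mapping.single (xs @ (a + b) # ys) 1)
        (Poly_Mapping.single (xs @ a # ys) 1 + Poly_Mapping.single (xs @ b # ys) 1)"
      unfolding wedge_rel_def by (simp only: diff_diff_eq span_base)
  qed
next
  fix xs ys :: "'a list" and a c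
  have *: "c *\<^sub>R Poly_Mapping.single zs (1::real) = Poly_Mapping.single zs c" for zs :: "'a list" and c
    by (rule poly_mapping_eqI) (simp add: lookup_scaleR lookup_single when_def)
  show "wedge (xs @ (c *\<^sub>R a) # ys) = c *\<^sub>R wedge (xs @ a # ys)"
  proof transfer
    fix xs ys :: "'a list" and a c
    have "Poly_Mapping.single (xs @ (c *\<^sub>R a) # ys) (1::real) - Poly_Mapping.single (xs @ a # ys) c
        \<in> wedge_relations"
      unfolding wedge_relations_def by blast
    then show "wedge_rel (Poly_Mapping.single (xs @ (c *\<^sub>R a) # ys) 1)
        (c *\<^sub>R Poly_Mapping.single (xs @ a # ys) 1)"
      unfolding wedge_rel_def by (simp only: * span_base)
  qed
next
  fix xs :: "'a list"
  assume "\<not> distinct xs"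
  then show "wedge xs = 0"
  proof transfer
    fix xs :: "'a list"
    assume "\<not> distinct xs"
    then have "Poly_Mapping.single xs (1::real) \<in> wedge_relations"
      unfolding wedge_relations_def by blast
    then show "wedge_rel (Poly_Mapping.single xs 1) 0"
      unfolding wedge_rel_def by (simp only: diff_zero span_base)
  qed
qed

lemma linear_exterior_eqI:
  assumes "linear F" "linear G" "\<And>xs. F (wedge xs) = G (wedge xs)"
  shows "F p = G p"
proof -
  have *: "c *\<^sub>R Poly_Mapping.single zs (1::real) = Poly_Mapping.single zs c" for zs :: "'a list" and c
    by (rule poly_mapping_eqI) (simp add: lookup_scaleR lookup_single when_def)
  have single: "F (abs_exterior (Poly_Mapping.single k x)) = G (abs_exterior (Poly_Mapping.single k x))" for k x
  proof -
    have "abs_exterior (Poly_Mapping.single k x) = x *\<^sub>R wedge k"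
      by (simp add: wedge.abs_eq scaleR_exterior.abs_eq *)
    then show ?thesis
      using assms by (simp add: linear_scale)
  qed
  have "F (abs_exterior r) = G (abs_exterior r)"
    if "Poly_Mapping.keys r \<subseteq> A" "finite A" for r A
    using that(2,1)
  proof (induction A arbitrary: r)
    case empty
    then have "r = Poly_Mapping.single [] 0"
      by simp
    then show ?case
      using single by metis
  next
    case (insert x A)
    let ?s = "Poly_Mapping.single x (Poly_Mapping.lookup r x)"
    have "Poly_Mapping.keys (r - ?s) \<subseteq> A"
      using insert.prems by (auto simp: in_keys_iff lookup_minus lookup_single when_def split: if_splits)
    then have "F (abs_exterior (r - ?s)) = G (abs_exterior (r - ?s))"
      by (rule insert.IH)
    moreover have "abs_exterior r = abs_exterior (r - ?s) + abs_exterior ?s"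
      by (simp add: plus_exterior.abs_eq)
    ultimately show ?case
      using assms(1,2) single by (simp add: linear_add)
  qed
  from this [OF order_refl finite_keys, of "rep_exterior p"] show ?thesis
    by (simp add: Quotient3_abs_rep [OF Quotient3_exterior])
qed


section \<open>Lie algebras and their homology differential\<close>

definition lie_algebra :: "('g::real_vector \<Rightarrow> 'g \<Rightarrow> 'g) \<Rightarrow> bool" where
  "lie_algebra br \<longleftrightarrow> bilinear br \<and> (\<forall>x. br x x = 0) \<and>
     (\<forall>x y z. br x (br y z) + br y (br z x) + br z (br x y) = 0)"

text \<open>Positions are counted from \<open>0\<close>, which does not change \<open>(-1)\<^bsup>i+j\<^esup>\<close>.\<close>

definition boundary_list :: "('g::real_vector \<Rightarrow> 'g \<Rightarrow> 'g) \<Rightarrow> 'g list \<Rightarrow> 'g exterior" where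
  "boundary_list br xs = (\<Sum>j<length xs. \<Sum>i<j. (- 1) ^ (i + j) *\<^sub>R
     wedge (br (xs ! i) (xs ! j) # delete_nth i (delete_nth j xs)))"

definition boundary :: "('g::real_vector \<Rightarrow> 'g \<Rightarrow> 'g) \<Rightarrow> 'g exterior \<Rightarrow> 'g exterior" where
  "boundary br = ext_lift (boundary_list br)"

definition cycles :: "('g::real_vector \<Rightarrow> 'g \<Rightarrow> 'g) \<Rightarrow> nat \<Rightarrow> 'g exterior set" where
  "cycles br k = {p \<in> ext_power k. boundary br p = 0}"

text \<open>The remainder of this section shows that \<open>boundary_list br\<close> is alternating multilinear, by
  the recursion \<open>\<partial>(x \<and> p) = - ad\<^sub>x p - x \<and> \<partial>p\<close>.\<close>

lemma alt_multilinearI: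
  assumes add: "\<And>xs a b ys. F (xs @ (a + b) # ys) = F (xs @ a # ys) + F (xs @ b # ys)"
    and scale: "\<And>xs c a ys. F (xs @ (c *\<^sub>R a) # ys) = c *\<^sub>R F (xs @ a # ys)"
    and eq: "\<And>x ys. F (x # x # ys) = 0"
    and step: "\<And>x ys. \<not> distinct ys \<Longrightarrow> F ys = 0 \<Longrightarrow> F (x # ys) = 0"
  shows "alt_multilinear F"
proof -
  have swap: "F (a # b # ys) = - F (b # a # ys)" for a b ys
  proof -
    have "F ((a + b) # (a + b) # ys) = 0"
      by (rule eq)
    then show ?thesis
      using add [of "[]" a b "(a + b) # ys"] add [of "[a]" a b ys] add [of "[b]" a b ys]
      by (simp add: eq eq_neg_iff_add_eq_0)
  qed
  have "F xs = 0" if "\<not> distinct xs" for xs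
    using that
  proof (induction "length xs" arbitrary: xs rule: less_induct)
    case less
    then obtain x ys where xs: "xs = x # ys"
      by (cases xs) auto
    show ?case
    proof (cases "distinct ys")
      case False
      then show ?thesis
        using less.hyps xs step by simp
    next
      case True
      then obtain us vs where ys: "ys = us @ x # vs"
        using less.prems xs by (auto simp: in_set_conv_decomp)
      show ?thesis
      proof (cases us)
        case Nil
        then show ?thesis using eq xs ys by simp
      next
        case (Cons u us')
        have "F (u # x # us' @ x # vs) = 0"
          by (rule step) (use less.hyps xs ys Cons in simp_all)
        then show ?thesis
          using swap [of x u "us' @ x # vs"] xs ys Cons by simp
      qed
    qed
  qed
  then show ?thesis
    using add scale unfolding alt_multilinear_def by blast
qed

lemma alt_multilinearD:
  assumes "alt_multilinear F"
  shows "F (xs @ (a + b) # ys) = F (xs @ a # ys) + F (xs @ b # ys)"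
    and "F (xs @ (c *\<^sub>R a) # ys) = c *\<^sub>R F (xs @ a # ys)"
    and "\<not> distinct xs \<Longrightarrow> F xs = 0"
  using assms unfolding alt_multilinear_def by blast+

lemma alt_multilinear_swap:
  assumes "alt_multilinear F"
  shows "F (xs @ a # b # ys) = - F (xs @ b # a # ys)"
proof -
  have add: "F (xs @ (a + b) # ys) = F (xs @ a # ys) + F (xs @ b # ys)" for xs a b ys
    using assms unfolding alt_multilinear_def by blast
  have eq: "F (xs @ a # a # ys) = 0" for xs a ys
    using assms unfolding alt_multilinear_def by simp
  have "F (xs @ (a + b) # (a + b) # ys) = 0"
    by (rule eq)
  then show ?thesis
    using add [of xs a b "(a + b) # ys"] add [of "xs @ [a]" a b ys] add [of "xs @ [b]" a b ys]
    by (simp add: eq eq_neg_iff_add_eq_0)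
qed

lemma alt_multilinear_move:
  assumes "alt_multilinear F"
  shows "F (ps @ ys @ y # zs) = (- 1) ^ length ys *\<^sub>R F (ps @ y # ys @ zs)"
proof (induction ys arbitrary: ps)
  case (Cons u ys)
  show ?case
    using Cons.IH [of "ps @ [u]"] alt_multilinear_swap [OF assms, of ps u y "ys @ zs"] by simp
qed simp

lemmas wedge_add = alt_multilinearD(1) [OF alt_multilinear_wedge]
lemmas wedge_scale = alt_multilinearD(2) [OF alt_multilinear_wedge]
lemmas wedge_not_distinct = alt_multilinearD(3) [OF alt_multilinear_wedge]

definition wedge_left :: "'g::real_vector \<Rightarrow> 'g exterior \<Rightarrow> 'g exterior" where
  "wedge_left x = ext_lift (\<lambda>xs. wedge (x # xs))"

lemma alt_multilinear_wedge_Cons: "alt_multilinear (\<lambda>xs. wedge (x # xs))"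
  unfolding alt_multilinear_def
proof (intro conjI allI impI)
  fix xs ys a b c
  show "wedge (x # xs @ (a + b) # ys) = wedge (x # xs @ a # ys) + wedge (x # xs @ b # ys)"
    using wedge_add [of "x # xs" a b ys] by simp
  show "wedge (x # xs @ (c *\<^sub>R a) # ys) = c *\<^sub>R wedge (x # xs @ a # ys)"
    using wedge_scale [of "x # xs" c a ys] by simp
next
  fix xs :: "'a list"
  assume "\<not> distinct xs"
  then show "wedge (x # xs) = 0"
    by (intro wedge_not_distinct) simp
qed

lemma wedge_left_wedge [simp]: "wedge_left x (wedge xs) = wedge (x # xs)"
  unfolding wedge_left_def by (rule ext_lift_wedge [OF alt_multilinear_wedge_Cons])

lemma linear_wedge_left: "linear (wedge_left x)"
  unfolding wedge_left_def by (rule linear_ext_lift [OF alt_multilinear_wedge_Cons])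

lemma wedge_left_add: "wedge_left (a + b) p = wedge_left a p + wedge_left b p"
proof (rule linear_exterior_eqI [where F = "wedge_left (a + b)" and G = "\<lambda>p. wedge_left a p + wedge_left b p"])
  show "linear (\<lambda>p. wedge_left a p + wedge_left b p)"
    by (rule linear_compose_add [OF linear_wedge_left linear_wedge_left])
qed (simp_all add: linear_wedge_left wedge_add [of "[]", simplified])

lemma wedge_left_scale: "wedge_left (c *\<^sub>R a) p = c *\<^sub>R wedge_left a p"
proof (rule linear_exterior_eqI [where F = "wedge_left (c *\<^sub>R a)" and G = "\<lambda>p. c *\<^sub>R wedge_left a p"])
  show "linear (\<lambda>p. c *\<^sub>R wedge_left a p)"
    by (rule linear_compose_scale_right [OF linear_wedge_left])
qed (simp_all add: linear_wedge_left wedge_scale [of "[]", simplified])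

lemma wedge_left_twice: "wedge_left a (wedge_left a p) = 0"
proof (rule linear_exterior_eqI [where F = "\<lambda>p. wedge_left a (wedge_left a p)" and G = "\<lambda>p. 0"])
  show "linear (\<lambda>p. wedge_left a (wedge_left a p))"
    using linear_compose [OF linear_wedge_left linear_wedge_left] by (simp add: o_def)
  show "linear (\<lambda>p. 0 :: 'a exterior)"
    by (rule linearI) simp_all
qed (simp add: wedge_not_distinct)

definition ad_list :: "('g::real_vector \<Rightarrow> 'g \<Rightarrow> 'g) \<Rightarrow> 'g \<Rightarrow> 'g list \<Rightarrow> 'g exterior" where
  "ad_list br x xs = (\<Sum>i<length xs. wedge (xs[i := br x (xs ! i)]))"

lemma ad_list_Nil [simp]: "ad_list br x [] = 0"
  by (simp add: ad_list_def)

lemma ad_list_Cons: "ad_list br x (y # ys) = wedge (br x y # ys) + wedge_left y (ad_list br x ys)"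
  by (simp add: ad_list_def sum.lessThan_Suc_shift linear_sum [OF linear_wedge_left] del: sum.lessThan_Suc)

lemma boundary_list_Nil [simp]: "boundary_list br [] = 0"
  by (simp add: boundary_list_def)

lemma wedge_update:
  assumes "i < length xs"
  shows "wedge (xs[i := y]) = (- 1) ^ i *\<^sub>R wedge (y # delete_nth i xs)"
  using alt_multilinear_move [OF alt_multilinear_wedge, of "[]" "take i xs" y "drop (Suc i) xs"] assms
  by (simp add: delete_nth_def upd_conv_take_nth_drop)

lemma boundary_list_Cons:
  "boundary_list br (x # xs) = - ad_list br x xs - wedge_left x (boundary_list br xs)"
proof -
  have [simp]: "delete_nth 0 (y # ys) = ys" "delete_nth (Suc i) (y # ys) = y # delete_nth i ys"
    for i ys and y :: 'a
    by (simp_all add: delete_nth_def)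
  have *: "wedge (a # x # zs) = - wedge_left x (wedge (a # zs))" for a zs
    using alt_multilinear_swap [OF alt_multilinear_wedge, of "[]" a x zs] by simp
  show ?thesis
    by (simp add: boundary_list_def ad_list_def sum.lessThan_Suc_shift wedge_update * sum.distrib
        linear_sum [OF linear_wedge_left] linear_scale [OF linear_wedge_left] sum_negf sum_subtractf
        del: sum.lessThan_Suc wedge_left_wedge)
qed

context
  fixes br :: "'g::real_vector \<Rightarrow> 'g \<Rightarrow> 'g"
  assumes br: "lie_algebra br"
begin

lemma br_simps:
  "br (a + b) z = br a z + br b z" "br z (a + b) = br z a + br z b"
  "br (c *\<^sub>R a) z = c *\<^sub>R br a z" "br z (c *\<^sub>R a) = c *\<^sub>R br z a" "br a a = 0"
  using br unfolding lie_algebra_def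
  by (simp_all add: bilinear_ladd bilinear_radd bilinear_lmul bilinear_rmul)

lemmas wl_simps = linear_add [OF linear_wedge_left] linear_scale [OF linear_wedge_left]
  linear_diff [OF linear_wedge_left] linear_neg [OF linear_wedge_left] linear_0 [OF linear_wedge_left]

lemmas wedge_multi =
  wedge_add [of "[]", simplified] wedge_add [of "[y]" for y, simplified]
  wedge_scale [of "[]", simplified] wedge_scale [of "[y]" for y, simplified]

lemma wedge_zero: "wedge (0 # xs) = 0"
  using wedge_scale [of "[]" 0] by simp

lemma alt_multilinear_ad_list: "alt_multilinear (ad_list br x)"
proof (rule alt_multilinearI)
  fix xs ys a b c
  show "ad_list br x (xs @ (a + b) # ys) = ad_list br x (xs @ a # ys) + ad_list br x (xs @ b # ys)"
    by (induction xs)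
      (simp_all add: ad_list_Cons br_simps wedge_multi wedge_left_add wl_simps
        wedge_add [of "z # zs" for z zs, simplified])
  show "ad_list br x (xs @ (c *\<^sub>R a) # ys) = c *\<^sub>R ad_list br x (xs @ a # ys)"
    by (induction xs)
      (simp_all add: ad_list_Cons br_simps wedge_multi wedge_left_scale wl_simps scaleR_right_distrib
        wedge_scale [of "z # zs" for z zs, simplified])
next
  fix y ys
  show "ad_list br x (y # y # ys) = 0"
    using alt_multilinear_swap [OF alt_multilinear_wedge, of "[]" y "br x y" ys]
    by (simp add: ad_list_Cons wl_simps wedge_left_twice)
next
  fix y ys
  assume "\<not> distinct ys" "ad_list br x ys = 0"
  then show "ad_list br x (y # ys) = 0"
    by (simp add: ad_list_Cons wl_simps wedge_not_distinct)
qed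

lemma ad_list_add: "ad_list br (a + b) xs = ad_list br a xs + ad_list br b xs"
  by (induction xs) (simp_all add: ad_list_Cons br_simps wedge_multi(1) linear_add [OF linear_wedge_left])

lemma ad_list_scale: "ad_list br (c *\<^sub>R a) xs = c *\<^sub>R ad_list br a xs"
  by (induction xs)
    (simp_all add: ad_list_Cons br_simps wedge_multi(3) linear_scale [OF linear_wedge_left] scaleR_right_distrib)

lemma alt_multilinear_boundary_list: "alt_multilinear (boundary_list br)"
proof (rule alt_multilinearI)
  note ad = alt_multilinearD [OF alt_multilinear_ad_list]
  fix xs ys a b c
  show "boundary_list br (xs @ (a + b) # ys) = boundary_list br (xs @ a # ys) + boundary_list br (xs @ b # ys)"
    by (induction xs)
      (simp_all add: boundary_list_Cons ad_list_add wedge_left_add wl_simps ad)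
  show "boundary_list br (xs @ (c *\<^sub>R a) # ys) = c *\<^sub>R boundary_list br (xs @ a # ys)"
    by (induction xs)
      (simp_all add: boundary_list_Cons ad_list_scale wedge_left_scale wl_simps ad scaleR_right_diff_distrib)
next
  fix y ys
  show "boundary_list br (y # y # ys) = 0"
    by (simp add: boundary_list_Cons ad_list_Cons br_simps wedge_zero wl_simps wedge_left_twice)
next
  fix y ys
  assume "\<not> distinct ys" "boundary_list br ys = 0"
  moreover have "ad_list br y ys = 0"
    using \<open>\<not> distinct ys\<close> alt_multilinear_ad_list unfolding alt_multilinear_def by blast
  ultimately show "boundary_list br (y # ys) = 0"
    by (simp add: boundary_list_Cons wl_simps)
qed

end


section \<open>Multisymplectic geometry\<close>

definition pre_plectic :: "'m::{t2_space, second_countable_topology} manifold \<Rightarrow> nat \<Rightarrow> 'm form \<Rightarrow> bool" where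
  "pre_plectic M n \<omega> \<longleftrightarrow> smooth_manifold M \<and> n \<ge> 1 \<and> \<omega> \<in> forms M (n + 1) \<and> closed_form M \<omega>"

definition hamiltonian_vf :: "'m manifold \<Rightarrow> 'm form \<Rightarrow> 'm form \<Rightarrow> 'm vfield \<Rightarrow> bool" where
  "hamiltonian_vf M \<omega> \<alpha> X \<longleftrightarrow> X \<in> vector_fields M \<and> ext_deriv M \<alpha> = - contract X \<omega>"

definition hamiltonian_forms :: "'m manifold \<Rightarrow> nat \<Rightarrow> 'm form \<Rightarrow> 'm form set" where
  "hamiltonian_forms M n \<omega> = {\<alpha> \<in> forms M (n - 1). \<exists>X. hamiltonian_vf M \<omega> \<alpha> X}"

definition multisymplectic_fields :: "'m manifold \<Rightarrow> 'm form \<Rightarrow> 'm vfield set" where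
  "multisymplectic_fields M \<omega> = {X \<in> vector_fields M. lie_deriv M X \<omega> = 0}"

definition multisymplectic_action ::
  "'m manifold \<Rightarrow> 'm form \<Rightarrow> ('g::real_vector \<Rightarrow> 'g \<Rightarrow> 'g) \<Rightarrow> ('g \<Rightarrow> 'm vfield) \<Rightarrow> bool" where
  "multisymplectic_action M \<omega> br v \<longleftrightarrow>
     (\<forall>x. v x \<in> multisymplectic_fields M \<omega>) \<and> linear v \<and>
     (\<forall>x y. v (br x y) = vf_bracket (v x) (v y))"

text \<open>\<open>\<iota>(v\<^sub>p)\<alpha>\<close>; here \<open>fold contract [X\<^sub>1, \<dots>, X\<^sub>k] \<alpha>\<close> is \<open>\<iota>\<^bsub>X\<^sub>k\<^esub> \<dots> \<iota>\<^bsub>X\<^sub>1\<^esub> \<alpha>\<close>.\<close>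

definition contract_along :: "('g::real_vector \<Rightarrow> 'm vfield) \<Rightarrow> 'g exterior \<Rightarrow> 'm form \<Rightarrow> 'm form" where
  "contract_along v p \<alpha> = ext_lift (\<lambda>xs. fold contract (map v xs) \<alpha>) p"

lemma const_smooth: "(\<lambda>_. c) \<in> smooth_functions M"
proof -
  have "Ck_on d k U (\<lambda>_. c)" for d k U c
    by (induction k arbitrary: c) (simp_all add: partial_deriv_def [abs_def])
  then show ?thesis
    by (auto simp: smooth_functions_def smooth_on_def o_def)
qed

lemma fold_contract: "fold contract Xs \<alpha> Ys = \<alpha> (Xs @ Ys)"
  by (induction Xs arbitrary: \<alpha>) (simp_all add: contract_def)

lemma forms_mult:
  assumes "\<alpha> \<in> forms M m" "g \<in> smooth_functions M" "X \<in> vector_fields M"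
    and "set (Xs @ Ys) \<subseteq> vector_fields M"
  shows "\<alpha> (Xs @ vf_mult g X # Ys) = g * \<alpha> (Xs @ X # Ys)"
  using assms unfolding forms_def by blast

lemma alt_multilinear_contract:
  assumes "linear v" "\<And>x. v x \<in> vector_fields M" "\<alpha> \<in> forms M m"
  shows "alt_multilinear (\<lambda>xs. fold contract (map v xs) \<alpha>)"
  unfolding alt_multilinear_def
proof (intro conjI allI impI)
  have v: "set (map v xs) \<subseteq> vector_fields M" for xs
    using assms(2) by auto
  have out: "\<alpha> Zs = 0" if "\<not> set Zs \<subseteq> vector_fields M" for Zs
    using assms(3) that by (auto simp: forms_def)
  fix xs ys a b c
  show "fold contract (map v (xs @ (a + b) # ys)) \<alpha> =
      fold contract (map v (xs @ a # ys)) \<alpha> + fold contract (map v (xs @ b # ys)) \<alpha>"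
  proof
    fix Zs
    show "fold contract (map v (xs @ (a + b) # ys)) \<alpha> Zs =
      (fold contract (map v (xs @ a # ys)) \<alpha> + fold contract (map v (xs @ b # ys)) \<alpha>) Zs"
    proof (cases "set Zs \<subseteq> vector_fields M")
      case True
      have "\<alpha> (map v xs @ (v a + v b) # (map v ys @ Zs)) =
          \<alpha> (map v xs @ v a # (map v ys @ Zs)) + \<alpha> (map v xs @ v b # (map v ys @ Zs))"
        using assms(3) assms(2) v True unfolding forms_def by simp
      then show ?thesis
        by (simp add: fold_contract linear_add [OF assms(1)] fun_eq_iff del: fold_append fold_simps)
    qed (simp add: fold_contract out fun_eq_iff del: fold_append fold_simps)
  qed
  show "fold contract (map v (xs @ (c *\<^sub>R a) # ys)) \<alpha> = c *\<^sub>R fold contract (map v (xs @ a # ys)) \<alpha>"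
  proof
    fix Zs
    show "fold contract (map v (xs @ (c *\<^sub>R a) # ys)) \<alpha> Zs =
      (c *\<^sub>R fold contract (map v (xs @ a # ys)) \<alpha>) Zs"
    proof (cases "set Zs \<subseteq> vector_fields M")
      case True
      have "v (c *\<^sub>R a) = vf_mult (\<lambda>_. c) (v a)"
        by (auto simp: linear_scale [OF assms(1)] vf_mult_def fun_eq_iff)
      moreover have "\<alpha> (map v xs @ vf_mult (\<lambda>_. c) (v a) # (map v ys @ Zs)) =
          (\<lambda>_. c) * \<alpha> (map v xs @ v a # (map v ys @ Zs))"
        by (rule forms_mult [OF assms(3) const_smooth]) (use assms(2) True in auto)
      ultimately show ?thesis
        by (simp add: fold_contract del: fold_append fold_simps) (simp add: fun_eq_iff)
    qed (simp add: fold_contract out fun_eq_iff del: fold_append fold_simps)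
  qed
next
  fix xs :: "'a list"
  assume "\<not> distinct xs"
  then have "\<not> distinct (map v xs @ Zs)" for Zs
    by (auto simp: distinct_map)
  then show "fold contract (map v xs) \<alpha> = 0"
    using assms(3) by (auto simp: fold_contract forms_def fun_eq_iff)
qed

definition varsigma :: "nat \<Rightarrow> real" where
  "varsigma k = - ((- 1) ^ (k * (k + 1) div 2))"

definition comomentum_map ::
  "'m manifold \<Rightarrow> nat \<Rightarrow> 'm form \<Rightarrow> ('g::real_vector \<Rightarrow> 'g \<Rightarrow> 'g) \<Rightarrow> ('g \<Rightarrow> 'm vfield) \<Rightarrow>
     (nat \<Rightarrow> 'g exterior \<Rightarrow> 'm form) \<Rightarrow> bool" where
  "comomentum_map M n \<omega> br v f \<longleftrightarrow>
     (\<forall>i\<in>{1..n}. linear_on_subspace (ext_power i) (f i) \<and> f i ` ext_power i \<subseteq> forms M (n - i)) \<and>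
     f 1 ` ext_power 1 \<subseteq> hamiltonian_forms M n \<omega> \<and>
     (\<forall>x. ext_deriv M (f 1 (wedge [x])) = - contract (v x) \<omega>) \<and>
     (let f' = (\<lambda>i. if i \<in> {1..n} then f i else 0) in
        \<forall>k\<in>{1..n + 1}. \<forall>p\<in>ext_power k.
          - f' (k - 1) (boundary br p) =
            ext_deriv M (f' k p) + varsigma k *\<^sub>R contract_along v p \<omega>)"

definition strictly_preserves ::
  "'m manifold \<Rightarrow> ('g \<Rightarrow> 'm vfield) \<Rightarrow> 'm form \<Rightarrow> bool" where
  "strictly_preserves M v H \<longleftrightarrow> (\<forall>x. lie_deriv M (v x) H = 0)"

definition globally_conserved :: "'m manifold \<Rightarrow> 'm vfield \<Rightarrow> nat \<Rightarrow> 'm form \<Rightarrow> bool" where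
  "globally_conserved M X k \<alpha> \<longleftrightarrow> exact_form M k (lie_deriv M X \<alpha>)"

end

theory Submission
  imports Defs
begin

text \<open>
  Write \<open>F = f\<^sub>k(p)\<close>. By Cartan's formula \<open>L\<^bsub>v\<^sub>H\<^esub> F = d \<iota>\<^bsub>v\<^sub>H\<^esub> F + \<iota>\<^bsub>v\<^sub>H\<^esub> dF\<close>, so it is enough to
  find a primitive of \<open>\<iota>\<^bsub>v\<^sub>H\<^esub> dF\<close>. Since \<open>\<partial>p = 0\<close>, the equation defining a co-momentum map reads
  \<open>dF = - \<varsigma>(k) \<iota>(v\<^sub>p) \<omega>\<close>. Moving \<open>\<iota>\<^bsub>v\<^sub>H\<^esub>\<close> past the \<open>k\<close> contractions of \<open>\<iota>(v\<^sub>p)\<close> costs a sign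
  \<open>(-1)\<^sup>k\<close> (\<open>contract_contract_along\<close>), and \<open>\<iota>\<^bsub>v\<^sub>H\<^esub> \<omega> = - dH\<close>; hence
  \<open>\<iota>\<^bsub>v\<^sub>H\<^esub> dF = (-1)\<^sup>k \<varsigma>(k) \<iota>(v\<^sub>p) dH\<close>.

  That \<open>\<iota>(v\<^sub>p) dH\<close> is exact comes from the invariance of \<open>H\<close> under the action: for every form
  \<open>\<alpha>\<close> with \<open>L\<^bsub>v\<^sub>x\<^esub> \<alpha> = 0\<close> for all \<open>x\<close>,
  \<open>\<iota>(v\<^sub>p) d\<alpha> = (-1)\<^sup>k d \<iota>(v\<^sub>p) \<alpha> - \<iota>(v\<^bsub>\<partial>p\<^esub>) \<alpha>\<close>
  (\<open>contract_along_ext_deriv\<close>), and the last term vanishes on cycles. The identity is first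
  proved for lists of vector fields (\<open>ext_deriv_contractions\<close>), by adding one vector field at
  a time with Cartan's formula, and then extended linearly to the exterior algebra. Altogether
  \<open>L\<^bsub>v\<^sub>H\<^esub> F = d(\<iota>\<^bsub>v\<^sub>H\<^esub> F + \<varsigma>(k) \<iota>(v\<^sub>p) H)\<close>. For \<open>k = n\<close> both terms in the bracket are \<open>0\<close>, as
  they contract a form with more vector fields than its degree.

  The forms of a given degree are a vector space because the smooth functions are one
  (\<open>subspace_smooth_functions\<close>); this makes the primitive found above a form, and it enters
  the polarisation argument by which forms change sign when two arguments are exchanged.
\<close>


section \<open>Sums and lists\<close>

lemma sum_apply: "(\<Sum>i\<in>A. f i) x = (\<Sum>i\<in>A. f i x)"
  for f :: "'a \<Rightarrow> 'b \<Rightarrow> 'c::comm_monoid_add"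
  by (induction A rule: infinite_finite_induct) simp_all

lemma sum_lessThan_add: "sum f {..<a + b} = sum f {..<a} + (\<Sum>i<b. f (a + i))"
  for f :: "nat \<Rightarrow> 'a::comm_monoid_add"
  by (induction b) (simp_all add: add.assoc)

lemma delete_nth_simps [simp]:
  "delete_nth 0 (y # ys) = ys" "delete_nth (Suc i) (y # ys) = y # delete_nth i ys"
  by (simp_all add: delete_nth_def)

lemma delete_nth_append:
  "i < length xs \<Longrightarrow> delete_nth i (xs @ ys) = delete_nth i xs @ ys"
  "delete_nth (length xs) (xs @ [y]) = xs"
  by (simp_all add: delete_nth_def)

lemma length_delete_nth: "i < length xs \<Longrightarrow> length (delete_nth i xs) = length xs - 1"
  by (simp add: delete_nth_def)


section \<open>Smooth functions form a vector space\<close>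

text \<open>Membership in \<open>U\<close> is stable under small changes of one of the first \<open>d\<close> coordinates. At a point of \<open>U\<close> the
  partial derivatives in these directions are therefore determined by the values of the
  function on \<open>U\<close>.\<close>

lemma Euclidean_space_open_line:
  assumes "openin (Euclidean_space d) U" "x \<in> U" "i < d"
  shows "\<forall>\<^sub>F t in nhds (x i). x(i := t) \<in> U"
proof -
  obtain T where T: "open T" "U = T \<inter> {x. \<forall>i\<ge>d. x i = 0}"
    using assms(1) unfolding Euclidean_space_def openin_subtopology
    by (auto simp: euclidean_product_topology)
  have "continuous_on UNIV (\<lambda>t. x(i := t))"
  proof (rule continuous_on_coordinatewise_then_product)
    show "continuous_on UNIV (\<lambda>t. (x(i := t)) j)" for j
      by (cases "j = i") auto
  qed
  then have "open ((\<lambda>t. x(i := t)) -` T)"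
    using T(1) by (simp add: open_vimage)
  moreover have "x i \<in> (\<lambda>t. x(i := t)) -` T"
    using assms(2) T(2) by simp
  ultimately have "\<forall>\<^sub>F t in nhds (x i). x(i := t) \<in> T"
    using eventually_nhds_in_open [of "(\<lambda>t. x(i := t)) -` T" "x i"] by simp
  then show ?thesis
  proof eventually_elim
    case (elim t)
    have "\<forall>j\<ge>d. (x(i := t)) j = 0"
      using assms(2,3) unfolding T(2) by simp
    with elim show ?case
      unfolding T(2) by simp
  qed
qed

text \<open>The combination \<open>h\<close> is prescribed on \<open>U\<close> only: its partial derivatives are in turn linear
  combinations of partial derivatives at the points of \<open>U\<close>, where the functions are
  differentiable, and in general not elsewhere. In this form the induction on \<open>k\<close> goes
  through.\<close>

lemma Ck_on_linear_combination:
  assumes "openin (Euclidean_space d) U"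
  shows "\<lbrakk>Ck_on d k U f; Ck_on d k U g; \<And>x. x \<in> U \<Longrightarrow> h x = f x + c * g x\<rbrakk> \<Longrightarrow> Ck_on d k U h"
proof (induction k arbitrary: f g h)
  case 0
  then have "continuous_on U (\<lambda>x. f x + c * g x)"
    by (auto intro!: continuous_intros)
  then show ?case
    using 0(3) by (simp cong: continuous_on_cong)
next
  case (Suc k)
  have "continuous_on U (\<lambda>x. f x + c * g x)"
    using Suc.prems by (auto intro!: continuous_intros)
  then have "continuous_on U h"
    using Suc.prems(3) by (simp cong: continuous_on_cong)
  moreover have D: "((\<lambda>t. h (x(i := t))) has_field_derivative
      partial_deriv i f x + c * partial_deriv i g x) (at (x i))" if "i < d" "x \<in> U" for i x
  proof -
    have diff: "(\<lambda>t. f (x(i := t))) field_differentiable (at (x i))"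
      "(\<lambda>t. g (x(i := t))) field_differentiable (at (x i))"
      using Suc.prems(1,2) that by (auto simp: field_differentiable_def real_differentiable_def)
    have "((\<lambda>t. f (x(i := t)) + c * g (x(i := t))) has_field_derivative
      partial_deriv i f x + c * partial_deriv i g x) (at (x i))"
      unfolding partial_deriv_def using diff
      by (auto intro!: derivative_eq_intros DERIV_deriv_iff_field_differentiable [THEN iffD2])
    moreover have "\<forall>\<^sub>F t in nhds (x i). h (x(i := t)) = f (x(i := t)) + c * g (x(i := t))"
      using Euclidean_space_open_line [OF assms that(2,1)] by eventually_elim (rule Suc.prems(3))
    ultimately show ?thesis
      by (subst DERIV_cong_ev [OF refl _ refl])
  qed
  moreover have "Ck_on d k U (partial_deriv i h)" if "i < d" for i
  proof (rule Suc.IH [of "partial_deriv i f" "partial_deriv i g"])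
    show "Ck_on d k U (partial_deriv i f)" "Ck_on d k U (partial_deriv i g)"
      using Suc.prems that by auto
    show "partial_deriv i h x = partial_deriv i f x + c * partial_deriv i g x" if "x \<in> U" for x
      unfolding partial_deriv_def [of i h] by (rule DERIV_imp_deriv [OF D]) fact+
  qed
  ultimately show ?case
    by (auto simp: real_differentiable_def)
qed

lemma smooth_functions_linear_combination:
  assumes "smooth_manifold M" "f \<in> smooth_functions M" "g \<in> smooth_functions M"
  shows "f + c *\<^sub>R g \<in> smooth_functions M"
proof -
  have "smooth_on (dim M) (\<phi> ` U) ((f + c *\<^sub>R g) \<circ> inv_into U \<phi>)" if "(U, \<phi>) \<in> atlas M" for U \<phi>
    unfolding smooth_on_def
  proof
    fix k
    have "openin (Euclidean_space (dim M)) (\<phi> ` U)"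
      using assms(1) that unfolding smooth_manifold_def is_chart_def by auto
    moreover have "Ck_on (dim M) k (\<phi> ` U) (f \<circ> inv_into U \<phi>)"
      "Ck_on (dim M) k (\<phi> ` U) (g \<circ> inv_into U \<phi>)"
      using assms(2,3) that unfolding smooth_functions_def smooth_on_def by auto
    ultimately show "Ck_on (dim M) k (\<phi> ` U) ((f + c *\<^sub>R g) \<circ> inv_into U \<phi>)"
      by (rule Ck_on_linear_combination [where c = c]) simp
  qed
  then show ?thesis
    by (auto simp: smooth_functions_def)
qed

lemma subspace_smooth_functions:
  assumes "smooth_manifold M"
  shows "subspace (smooth_functions M)"
proof (rule subspaceI)
  show 0: "0 \<in> smooth_functions M"
    using const_smooth [of 0 M] by (simp add: zero_fun_def)
  show "f + g \<in> smooth_functions M"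
    if "f \<in> smooth_functions M" "g \<in> smooth_functions M" for f g
    using smooth_functions_linear_combination [OF assms that, of 1] by simp
  show "c *\<^sub>R f \<in> smooth_functions M" if "f \<in> smooth_functions M" for c f
    using smooth_functions_linear_combination [OF assms 0 that, of c] by simp
qed


section \<open>Forms as alternating functions of lists of vector fields\<close>

lemma vector_field_linear:
  assumes "X \<in> vector_fields M" "f \<in> smooth_functions M"
  shows "g \<in> smooth_functions M \<Longrightarrow> X (f + g) = X f + X g"
    and "X (c *\<^sub>R f) = c *\<^sub>R X f"
  using assms by (auto simp: vector_fields_def linear_on_subspace_def)

lemma formsD:
  assumes "\<alpha> \<in> forms M m"
  shows forms_outside: "\<not> (set Xs \<subseteq> vector_fields M \<and> length Xs = m) \<Longrightarrow> \<alpha> Xs = 0"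
    and forms_add: "\<lbrakk>X \<in> vector_fields M; Y \<in> vector_fields M; set (Xs @ Ys) \<subseteq> vector_fields M\<rbrakk>
      \<Longrightarrow> \<alpha> (Xs @ (X + Y) # Ys) = \<alpha> (Xs @ X # Ys) + \<alpha> (Xs @ Y # Ys)"
    and forms_not_distinct: "\<not> distinct Xs \<Longrightarrow> \<alpha> Xs = 0"
  using assms unfolding forms_def by blast+

text \<open>For a vector field \<open>Z\<close>, or \<open>- Z\<close>, this is homogeneity with the constant function \<open>-1\<close>; in
  all other cases both sides are \<open>0\<close>, as a form vanishes off the lists of vector fields. In
  this generality the sign rule applies directly to Lie brackets.\<close>

lemma forms_uminus:
  assumes \<alpha>: "\<alpha> \<in> forms M m"
  shows "\<alpha> (Xs @ (- Z) # Ys) = - \<alpha> (Xs @ Z # Ys)"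
proof (cases "set (Xs @ Ys) \<subseteq> vector_fields M")
  case True
  have *: "\<alpha> (Xs @ (- W) # Ys) = - \<alpha> (Xs @ W # Ys)" if "W \<in> vector_fields M" for W
  proof -
    have "- W = vf_mult (\<lambda>_. - 1) W"
      by (auto simp: vf_mult_def fun_eq_iff)
    then show ?thesis
      using forms_mult [OF \<alpha> const_smooth that True, of "- 1"] by auto
  qed
  show ?thesis
  proof (cases "Z \<in> vector_fields M \<or> - Z \<in> vector_fields M")
    case True
    then show ?thesis
      using * [of Z] * [of "- Z"] by auto
  next
    case False
    then show ?thesis
      by (simp add: forms_outside [OF \<alpha>])
  qed
next
  case False
  then have "\<not> set (Xs @ W # Ys) \<subseteq> vector_fields M" for W
    by auto
  then show ?thesis
    using forms_outside [OF \<alpha>] by (metis neg_0_equal_iff_equal)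
qed

lemma contract_linear:
  "contract X 0 = 0"
  "contract X (\<alpha> + \<beta>) = contract X \<alpha> + contract X \<beta>"
  "contract X (c *\<^sub>R \<alpha>) = c *\<^sub>R contract X \<alpha>"
  by (simp_all add: contract_def fun_eq_iff)

lemma linear_contract: "linear (contract X)"
  by (rule linearI) (simp_all add: contract_linear)

text \<open>For \<open>Xs = [X\<^sub>0, \<dots>]\<close> this is the contraction with the image of \<open>X\<^sub>0 \<and> X\<^sub>1 \<and> \<dots>\<close> under the
  homology differential of the Lie algebra of vector fields.\<close>

definition bracket_contraction :: "'m vfield list \<Rightarrow> 'm form \<Rightarrow> 'm form" where
  "bracket_contraction Xs \<alpha> = (\<Sum>j<length Xs. \<Sum>i<j. (- 1) ^ (i + j) *\<^sub>R
     fold contract (vf_bracket (Xs ! i) (Xs ! j) # delete_nth i (delete_nth j Xs)) \<alpha>)"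

lemma bracket_contraction_snoc:
  "bracket_contraction (Xs @ [X]) \<alpha> = contract X (bracket_contraction Xs \<alpha>) +
    (\<Sum>i<length Xs. (- 1) ^ (i + length Xs) *\<^sub>R
      fold contract (vf_bracket (Xs ! i) X # delete_nth i Xs) \<alpha>)"
  by (simp add: bracket_contraction_def linear_sum [OF linear_contract] contract_linear
      nth_append delete_nth_append length_delete_nth)

context
  fixes M :: "'m::{t2_space, second_countable_topology} manifold"
  assumes M: "smooth_manifold M"
begin

lemmas smooth_0 = subspace_0 [OF subspace_smooth_functions [OF M]]
lemmas smooth_add = subspace_add [OF subspace_smooth_functions [OF M]]
lemmas smooth_scale = subspace_scale [OF subspace_smooth_functions [OF M]]

lemma forms_smooth: "\<alpha> \<in> forms M m \<Longrightarrow> \<alpha> Xs \<in> smooth_functions M"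
  using smooth_0 unfolding forms_def by (cases "set Xs \<subseteq> vector_fields M \<and> length Xs = m") auto

lemma vector_fields_add:
  assumes "X \<in> vector_fields M" "Y \<in> vector_fields M"
  shows "X + Y \<in> vector_fields M"
  using assms smooth_add unfolding vector_fields_def linear_on_subspace_def
  by (simp add: algebra_simps)

lemma subspace_forms: "subspace (forms M m)"
proof (rule subspaceI)
  show "0 \<in> forms M m"
    using smooth_0 by (simp add: forms_def)
  fix \<alpha> \<beta> c
  assume \<alpha>: "\<alpha> \<in> forms M m"
  show "c *\<^sub>R \<alpha> \<in> forms M m"
    using \<alpha> smooth_scale unfolding forms_def
    by (simp add: scaleR_right_distrib) (simp add: fun_eq_iff)
  assume \<beta>: "\<beta> \<in> forms M m"
  show "\<alpha> + \<beta> \<in> forms M m"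
    using \<alpha> \<beta> smooth_add unfolding forms_def by (simp add: algebra_simps)
qed

text \<open>The truncated \<open>m - 1\<close> makes this true for \<open>m = 0\<close> as well, since \<open>0\<close> is a form of every
  degree. Iterated contractions then need no distinction between low and high degrees.\<close>

lemma contract_forms:
  assumes \<alpha>: "\<alpha> \<in> forms M m" and X: "X \<in> vector_fields M"
  shows "contract X \<alpha> \<in> forms M (m - 1)"
proof (cases m)
  case 0
  then have "contract X \<alpha> = 0"
    by (simp add: contract_def fun_eq_iff forms_outside [OF \<alpha>])
  then show ?thesis
    using subspace_0 [OF subspace_forms] by simp
next
  case (Suc l)
  then show ?thesis
    using \<alpha> X forms_add [OF \<alpha>, of _ _ "X # Xs" for Xs] forms_mult [OF \<alpha>, of _ _ "X # Xs" for Xs]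
      forms_outside [OF \<alpha>] forms_not_distinct [OF \<alpha>]
    by (auto simp: forms_def contract_def)
qed

lemma fold_contract_forms:
  assumes "\<alpha> \<in> forms M m" "set Xs \<subseteq> vector_fields M"
  shows "fold contract Xs \<alpha> \<in> forms M (m - length Xs)"
  using assms(2)
proof (induction Xs rule: rev_induct)
  case (snoc X Xs)
  then show ?case
    using contract_forms [of "fold contract Xs \<alpha>" "m - length Xs" X] by simp
qed (simp add: assms(1))

text \<open>Polarisation: expand the value at a list in which \<open>X + Y\<close> occurs twice in a row.\<close>

lemma forms_swap:
  assumes \<alpha>: "\<alpha> \<in> forms M m"
  shows "\<alpha> (Xs @ X # Y # Ys) = - \<alpha> (Xs @ Y # X # Ys)"
proof (cases "set (Xs @ X # Y # Ys) \<subseteq> vector_fields M")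
  case True
  then have XY: "X + Y \<in> vector_fields M"
    using vector_fields_add by auto
  have eq: "\<alpha> (Xs @ Z # Z # Ys) = 0" for Z
    by (rule forms_not_distinct [OF \<alpha>]) simp
  have "\<alpha> (Xs @ (X + Y) # (X + Y) # Ys) = 0"
    by (rule eq)
  then show ?thesis
    using forms_add [OF \<alpha>, of X Y Xs "(X + Y) # Ys"] forms_add [OF \<alpha>, of X Y "Xs @ [X]" Ys]
      forms_add [OF \<alpha>, of X Y "Xs @ [Y]" Ys] True XY
    by (simp add: eq eq_neg_iff_add_eq_0)
next
  case False
  then show ?thesis
    by (subst (1 2) forms_outside [OF \<alpha>]) auto
qed

lemma forms_move:
  assumes \<alpha>: "\<alpha> \<in> forms M m"
  shows "\<alpha> (Xs @ Ys @ Y # Zs) = (- 1) ^ length Ys *\<^sub>R \<alpha> (Xs @ Y # Ys @ Zs)"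
proof (induction Ys arbitrary: Xs)
  case (Cons U Ys)
  show ?case
    using Cons.IH [of "Xs @ [U]"] forms_swap [OF \<alpha>, of Xs U Y "Ys @ Zs"] by simp
qed simp

lemma forms_update:
  assumes "\<alpha> \<in> forms M m" "i < length Xs"
  shows "\<alpha> (Xs[i := Y] @ Ys) = (- 1) ^ i *\<^sub>R \<alpha> (Y # delete_nth i Xs @ Ys)"
  using forms_move [OF assms(1), of "[]" "take i Xs" Y "drop (Suc i) Xs @ Ys"] assms(2)
  by (simp add: delete_nth_def upd_conv_take_nth_drop)


section \<open>Cartan calculus\<close>

text \<open>In the invariant formula for \<open>d\<alpha>(X, Y\<^sub>0, \<dots>)\<close> the terms that differentiate along \<open>X\<close> or
  contain a bracket with \<open>X\<close> make up the Lie derivative; in the others \<open>X\<close> is an argument of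
  \<open>\<alpha>\<close>, and they cancel against \<open>d \<iota>\<^sub>X \<alpha>\<close>, the opposite signs coming from the shift of the
  positions by one.\<close>

lemma Cartan_formula:
  assumes \<alpha>: "\<alpha> \<in> forms M m" and X: "X \<in> vector_fields M"
  shows "lie_deriv M X \<alpha> = ext_deriv M (contract X \<alpha>) + contract X (ext_deriv M \<alpha>)"
proof
  fix Ys
  show "lie_deriv M X \<alpha> Ys = (ext_deriv M (contract X \<alpha>) + contract X (ext_deriv M \<alpha>)) Ys"
  proof (cases "set Ys \<subseteq> vector_fields M")
    case True
    have swap: "\<alpha> (vf_bracket Y Z # X # Zs) = - \<alpha> (X # vf_bracket Y Z # Zs)" for Y Z Zs
      using forms_swap [OF \<alpha>, of "[]"] by (metis append_Nil)
    have upd: "\<alpha> (Ys[i := Z]) = (- 1) ^ i *\<^sub>R \<alpha> (Z # delete_nth i Ys)" if "i < length Ys" for i Z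
      using forms_update [OF \<alpha> that, of Z "[]"] by (simp only: append_Nil2)
    have "ext_deriv M \<alpha> (X # Ys) = X (\<alpha> Ys)
        - (\<Sum>i<length Ys. (- 1) ^ i *\<^sub>R (Ys ! i) (\<alpha> (X # delete_nth i Ys)))
        - (\<Sum>j<length Ys. \<alpha> (Ys[j := vf_bracket X (Ys ! j)]))
        - (\<Sum>j<length Ys. \<Sum>i<j. (- 1) ^ (i + j) *\<^sub>R
            \<alpha> (X # vf_bracket (Ys ! i) (Ys ! j) # delete_nth i (delete_nth j Ys)))"
      using True X
      by (simp add: ext_deriv_def sum.lessThan_Suc_shift swap upd sum.distrib sum_negf sum_subtractf
          del: sum.lessThan_Suc)
    then show ?thesis
      using True by (simp add: lie_deriv_def ext_deriv_def contract_def)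
  qed (simp add: lie_deriv_def ext_deriv_def contract_def)
qed

text \<open>The Lie derivative is a derivation of contraction, so if \<open>L\<^sub>X \<alpha> = 0\<close> it only acts on the
  contracting vector fields.\<close>

lemma lie_deriv_contractions:
  assumes \<alpha>: "\<alpha> \<in> forms M m" and inv: "lie_deriv M X \<alpha> = 0" and Xs: "set Xs \<subseteq> vector_fields M"
  shows "lie_deriv M X (fold contract Xs \<alpha>) =
    (\<Sum>i<length Xs. fold contract (Xs[i := vf_bracket X (Xs ! i)]) \<alpha>)"
proof
  fix Ys
  show "lie_deriv M X (fold contract Xs \<alpha>) Ys =
    (\<Sum>i<length Xs. fold contract (Xs[i := vf_bracket X (Xs ! i)]) \<alpha>) Ys"
  proof (cases "set Ys \<subseteq> vector_fields M")
    case True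
    have "0 = lie_deriv M X \<alpha> (Xs @ Ys)"
      by (simp add: inv)
    also have "\<dots> = X (\<alpha> (Xs @ Ys)) - ((\<Sum>i<length Xs. \<alpha> (Xs[i := vf_bracket X (Xs ! i)] @ Ys))
        + (\<Sum>i<length Ys. \<alpha> (Xs @ Ys[i := vf_bracket X (Ys ! i)])))"
      using True Xs by (simp add: lie_deriv_def sum_lessThan_add nth_append list_update_append)
    also have "\<dots> = lie_deriv M X (fold contract Xs \<alpha>) Ys
        - (\<Sum>i<length Xs. \<alpha> (Xs[i := vf_bracket X (Xs ! i)] @ Ys))"
      using True by (simp add: lie_deriv_def fold_contract)
    finally show ?thesis
      by (simp add: sum_apply fold_contract)
  next
    case False
    then have "\<alpha> (Zs @ Ys) = 0" for Zs
      using forms_outside [OF \<alpha>] by simp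
    then show ?thesis
      using False by (simp add: lie_deriv_def fold_contract sum_apply fun_eq_iff)
  qed
qed

lemma ext_deriv_linear_combination:
  assumes "\<And>Xs. \<alpha> Xs \<in> smooth_functions M" "\<And>Xs. \<beta> Xs \<in> smooth_functions M"
  shows "ext_deriv M (\<alpha> + c *\<^sub>R \<beta>) = ext_deriv M \<alpha> + c *\<^sub>R ext_deriv M \<beta>"
proof
  fix Xs
  show "ext_deriv M (\<alpha> + c *\<^sub>R \<beta>) Xs = (ext_deriv M \<alpha> + c *\<^sub>R ext_deriv M \<beta>) Xs"
  proof (cases "set Xs \<subseteq> vector_fields M")
    case True
    have "(Xs ! i) (\<alpha> Ys + c *\<^sub>R \<beta> Ys) = (Xs ! i) (\<alpha> Ys) + c *\<^sub>R (Xs ! i) (\<beta> Ys)" if "i < length Xs" for i Ys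
      using that True assms smooth_scale vector_field_linear [of "Xs ! i" M]
      by (simp add: subset_iff)
    then show ?thesis
      using True
      by (simp add: ext_deriv_def scaleR_right_distrib sum.distrib scaleR_sum_right
          mult.commute [of c])
  qed (simp add: ext_deriv_def)
qed

lemma lie_deriv_contractions_bracket_first:
  assumes \<alpha>: "\<alpha> \<in> forms M m" and inv: "lie_deriv M X \<alpha> = 0" and Xs: "set Xs \<subseteq> vector_fields M"
  shows "lie_deriv M X (fold contract Xs \<alpha>) =
    - (\<Sum>i<length Xs. (- 1) ^ i *\<^sub>R fold contract (vf_bracket (Xs ! i) X # delete_nth i Xs) \<alpha>)"
proof -
  have "fold contract (Xs[i := vf_bracket X (Xs ! i)]) \<alpha> =
      - ((- 1) ^ i *\<^sub>R fold contract (vf_bracket (Xs ! i) X # delete_nth i Xs) \<alpha>)"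
    if "i < length Xs" for i
  proof
    fix Ys
    have "vf_bracket X (Xs ! i) = - vf_bracket (Xs ! i) X"
      by (simp add: vf_bracket_def fun_eq_iff)
    then have "\<alpha> (vf_bracket X (Xs ! i) # Zs) = - \<alpha> (vf_bracket (Xs ! i) X # Zs)" for Zs
      using forms_uminus [OF \<alpha>, of "[]" "vf_bracket (Xs ! i) X" Zs] by simp
    then show "fold contract (Xs[i := vf_bracket X (Xs ! i)]) \<alpha> Ys =
      (- ((- 1) ^ i *\<^sub>R fold contract (vf_bracket (Xs ! i) X # delete_nth i Xs) \<alpha>)) Ys"
      by (simp only: uminus_apply scaleR_fun_apply fold_contract append_Cons
          forms_update [OF \<alpha> that] scaleR_minus_right)
        (simp only: fun_Compl_def scaleR_fun_apply)
  qed
  then show ?thesis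
    by (simp add: lie_deriv_contractions [OF assms] sum_negf)
qed

text \<open>Appending \<open>X\<close> to \<open>Xs\<close> applies \<open>\<iota>\<^sub>X\<close> to the identity for \<open>Xs\<close>. By Cartan's formula
  \<open>\<iota>\<^sub>X d = L\<^sub>X - d \<iota>\<^sub>X\<close>: the second part gives the new leading term, and the first yields the
  brackets of \<open>X\<close> with the members of \<open>Xs\<close>, which are the terms that \<open>bracket_contraction\<close>
  gains. The induction appends at the end because the outermost contraction is the last one;
  so \<open>L\<^sub>X\<close> meets contractions of the invariant form \<open>\<alpha>\<close> itself.\<close>

lemma ext_deriv_contractions:
  assumes \<alpha>: "\<alpha> \<in> forms M m" and "set Xs \<subseteq> vector_fields M"
    and "\<And>X. X \<in> set Xs \<Longrightarrow> lie_deriv M X \<alpha> = 0"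
  shows "fold contract Xs (ext_deriv M \<alpha>) =
    (- 1) ^ length Xs *\<^sub>R ext_deriv M (fold contract Xs \<alpha>) - bracket_contraction Xs \<alpha>"
  using assms(2,3)
proof (induction Xs rule: rev_induct)
  case Nil
  then show ?case
    by (simp add: bracket_contraction_def)
next
  case (snoc X Xs)
  let ?I = "fold contract Xs \<alpha>"
  have X: "X \<in> vector_fields M" and Xs: "set Xs \<subseteq> vector_fields M"
    using snoc.prems(1) by auto
  have inv: "lie_deriv M X \<alpha> = 0"
    by (rule snoc.prems(2)) simp
  let ?a = "(- 1) ^ length Xs :: real"
  let ?S = "\<Sum>i<length Xs. (- 1) ^ (i + length Xs) *\<^sub>R
    fold contract (vf_bracket (Xs ! i) X # delete_nth i Xs) \<alpha>"
  have L: "?a *\<^sub>R lie_deriv M X ?I = - ?S"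
    by (simp only: lie_deriv_contractions_bracket_first [OF \<alpha> inv Xs] scaleR_minus_right scaleR_sum_right
        scaleR_scaleR power_add mult.commute)
  \<comment> \<open>\<open>l\<close> and \<open>e\<close> stand for \<open>L\<^sub>X\<close> and \<open>d \<iota>\<^sub>X\<close> of the contracted form.\<close>
  have alg: "?a *\<^sub>R (l - e) - c = (- ?a) *\<^sub>R e - (c + s)" if "?a *\<^sub>R l = - s" for l e c s :: "'m form"
    by (simp add: scaleR_right_diff_distrib that)
  have "fold contract (Xs @ [X]) (ext_deriv M \<alpha>) =
      ?a *\<^sub>R contract X (ext_deriv M ?I) - contract X (bracket_contraction Xs \<alpha>)"
    using snoc.IH [OF Xs snoc.prems(2)]
    by (simp only: fold_append comp_apply fold_simps id_apply linear_diff [OF linear_contract]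
        linear_scale [OF linear_contract] set_append Un_iff simp_thms)
  also have "contract X (ext_deriv M ?I) = lie_deriv M X ?I - ext_deriv M (contract X ?I)"
    using Cartan_formula [OF fold_contract_forms [OF \<alpha> Xs] X] by simp
  also have "?a *\<^sub>R (lie_deriv M X ?I - ext_deriv M (contract X ?I)) - contract X (bracket_contraction Xs \<alpha>)
      = (- ?a) *\<^sub>R ext_deriv M (contract X ?I) - (contract X (bracket_contraction Xs \<alpha>) + ?S)"
    by (rule alg [OF L])
  finally show ?case
    by (simp add: bracket_contraction_snoc)
qed

end


section \<open>Contraction along elements of the exterior algebra\<close>

lemma contract_along_uminus: "contract_along v p (- \<alpha>) = - contract_along v p \<alpha>"
proof -
  have "fold contract Xs (- \<alpha>) = - fold contract Xs \<alpha>" for Xs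
    by (simp add: fold_contract fun_eq_iff)
  then show ?thesis
    by (simp add: contract_along_def ext_lift_def lin_extend_def sum_negf)
qed

context
  fixes M :: "'m::{t2_space, second_countable_topology} manifold"
    and v :: "'g::real_vector \<Rightarrow> 'm vfield"
  assumes M: "smooth_manifold M" and linear_v: "linear v" and v: "\<And>x. v x \<in> vector_fields M"
begin

lemma v_list: "set (map v xs) \<subseteq> vector_fields M"
  using v by auto

lemma contract_along_wedge:
  "\<alpha> \<in> forms M m \<Longrightarrow> contract_along v (wedge xs) \<alpha> = fold contract (map v xs) \<alpha>"
  unfolding contract_along_def by (rule ext_lift_wedge [OF alt_multilinear_contract [OF linear_v v]])

lemma linear_contract_along: "\<alpha> \<in> forms M m \<Longrightarrow> linear (\<lambda>p. contract_along v p \<alpha>)"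
  unfolding contract_along_def by (rule linear_ext_lift [OF alt_multilinear_contract [OF linear_v v]])

lemma contract_along_forms:
  assumes \<alpha>: "\<alpha> \<in> forms M m" and p: "p \<in> ext_power k"
  shows "contract_along v p \<alpha> \<in> forms M (m - k)"
proof -
  have "subspace {p. contract_along v p \<alpha> \<in> forms M (m - k)}"
    using linear_subspace_vimage [OF linear_contract_along [OF \<alpha>] subspace_forms [OF M]]
    by (simp add: vimage_def)
  moreover have "wedge xs \<in> {p. contract_along v p \<alpha> \<in> forms M (m - k)}" if "length xs = k" for xs
    using fold_contract_forms [OF M \<alpha> v_list, of xs] that by (simp add: contract_along_wedge [OF \<alpha>])
  ultimately show ?thesis
    using p span_minimal [of "{wedge xs | xs. length xs = k}"] unfolding ext_power_def by blast
qed

text \<open>This settles \<open>k = n\<close>, where the only exact form is \<open>0\<close>.\<close>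

lemma contract_along_degree:
  assumes \<alpha>: "\<alpha> \<in> forms M m" and p: "p \<in> ext_power k" and "m < k"
  shows "contract_along v p \<alpha> = 0"
proof (rule linear_eq_0_on_span [OF linear_contract_along [OF \<alpha>]])
  show "p \<in> span {wedge xs | xs. length xs = k}"
    using p by (simp add: ext_power_def)
  show "contract_along v q \<alpha> = 0" if "q \<in> {wedge xs | xs. length xs = k}" for q
    using that \<open>m < k\<close> by (auto simp: contract_along_wedge [OF \<alpha>] fold_contract fun_eq_iff forms_outside [OF \<alpha>])
qed

lemma contract_contract_along:
  assumes \<alpha>: "\<alpha> \<in> forms M m" and X: "X \<in> vector_fields M" and p: "p \<in> ext_power k"
  shows "contract X (contract_along v p \<alpha>) = (- 1) ^ k *\<^sub>R contract_along v p (contract X \<alpha>)"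
proof (rule linear_eq_on_span)
  show "linear (\<lambda>p. contract X (contract_along v p \<alpha>))"
    using linear_compose [OF linear_contract_along [OF \<alpha>] linear_contract] by (simp add: o_def)
  show "linear (\<lambda>p. (- 1) ^ k *\<^sub>R contract_along v p (contract X \<alpha>))"
    by (intro linear_compose_scale_right linear_contract_along [OF contract_forms [OF M \<alpha> X]])
  show "p \<in> span {wedge xs | xs. length xs = k}"
    using p by (simp add: ext_power_def)
  show "contract X (contract_along v q \<alpha>) = (- 1) ^ k *\<^sub>R contract_along v q (contract X \<alpha>)"
    if q: "q \<in> {wedge xs | xs. length xs = k}" for q
  proof -
    obtain xs where xs: "q = wedge xs" "length xs = k"
      using q by auto
    have "\<alpha> (map v xs @ X # Ys) = (- 1) ^ k *\<^sub>R \<alpha> (X # map v xs @ Ys)" for Ys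
      using forms_move [OF M \<alpha>, of "[]" "map v xs" X Ys] xs by simp
    then show ?thesis
      by (simp only: xs(1) contract_along_wedge [OF \<alpha>] contract_along_wedge [OF contract_forms [OF M \<alpha> X]])
        (simp add: fold_contract contract_def fun_eq_iff)
  qed
qed

lemma contract_along_boundary_wedge:
  assumes \<alpha>: "\<alpha> \<in> forms M m" and br: "lie_algebra br"
    and hom: "\<And>x y. v (br x y) = vf_bracket (v x) (v y)"
  shows "contract_along v (boundary br (wedge xs)) \<alpha> = bracket_contraction (map v xs) \<alpha>"
proof -
  note lin = linear_contract_along [OF \<alpha>]
  have map_delete: "map v (delete_nth i ys) = delete_nth i (map v ys)" for i ys
    by (simp add: delete_nth_def take_map drop_map)
  show ?thesis
    by (simp add: boundary_def ext_lift_wedge [OF alt_multilinear_boundary_list [OF br]] boundary_list_def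
        linear_sum [OF lin] linear_scale [OF lin] contract_along_wedge [OF \<alpha>]
        bracket_contraction_def hom map_delete cong: sum.cong_simp)
qed

text \<open>Both sides are linear in \<open>p\<close>, so \<open>p\<close> may be taken to be a decomposable \<open>x\<^sub>1 \<and> \<dots> \<and> x\<^sub>k\<close>,
  where \<open>v\<^bsub>\<partial>p\<^esub>\<close> is made of brackets of vector fields because \<open>v\<close> is a homomorphism.\<close>

lemma contract_along_ext_deriv:
  assumes \<alpha>: "\<alpha> \<in> forms M m" and d\<alpha>: "ext_deriv M \<alpha> \<in> forms M l" and br: "lie_algebra br"
    and hom: "\<And>x y. v (br x y) = vf_bracket (v x) (v y)"
    and inv: "\<And>x. lie_deriv M (v x) \<alpha> = 0"
    and p: "p \<in> ext_power k"
  shows "contract_along v p (ext_deriv M \<alpha>) =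
    (- 1) ^ k *\<^sub>R ext_deriv M (contract_along v p \<alpha>) - contract_along v (boundary br p) \<alpha>"
proof (rule linear_eq_on_span [where f = "\<lambda>p. contract_along v p (ext_deriv M \<alpha>)" and g =
      "\<lambda>p. (- 1) ^ k *\<^sub>R ext_deriv M (contract_along v p \<alpha>) - contract_along v (boundary br p) \<alpha>"])
  note lin = linear_contract_along [OF \<alpha>]
  \<comment> \<open>Vector fields are linear on smooth functions only, so linearity of \<open>d\<close> requires smooth
    values, here for \<open>q\<close> of mixed degree too.\<close>
  have smooth: "contract_along v q \<alpha> Xs \<in> smooth_functions M" for q Xs
  proof -
    have "contract_along v q \<alpha> Xs = (\<Sum>ys\<in>Poly_Mapping.keys (rep_exterior q).
        Poly_Mapping.lookup (rep_exterior q) ys *\<^sub>R fold contract (map v ys) \<alpha> Xs)"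
      by (simp add: contract_along_def ext_lift_def lin_extend_def sum_apply [of _ _ Xs])
    then show ?thesis
      by (simp only:) (intro subspace_sum subspace_scale subspace_smooth_functions [OF M]
        forms_smooth [OF M fold_contract_forms [OF M \<alpha> v_list]])
  qed
  have "linear (\<lambda>p. ext_deriv M (contract_along v p \<alpha>))"
  proof (rule linearI)
    have comb: "ext_deriv M (contract_along v a \<alpha> + c *\<^sub>R contract_along v b \<alpha>) =
        ext_deriv M (contract_along v a \<alpha>) + c *\<^sub>R ext_deriv M (contract_along v b \<alpha>)" for a b c
      by (rule ext_deriv_linear_combination [OF M smooth smooth])
    show "ext_deriv M (contract_along v (a + b) \<alpha>) =
        ext_deriv M (contract_along v a \<alpha>) + ext_deriv M (contract_along v b \<alpha>)" for a b
      using comb [of a 1 b] by (simp add: linear_add [OF lin])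
    then have "ext_deriv M (contract_along v 0 \<alpha>) = 0"
      by (metis add_0 add_cancel_left_left)
    then show "ext_deriv M (contract_along v (c *\<^sub>R b) \<alpha>) =
        c *\<^sub>R ext_deriv M (contract_along v b \<alpha>)" for c b
      using comb [of 0 c b] by (simp add: linear_scale [OF lin] linear_0 [OF lin])
  qed
  moreover have "linear (\<lambda>p. contract_along v (boundary br p) \<alpha>)"
    using linear_compose [OF linear_ext_lift [OF alt_multilinear_boundary_list [OF br]] lin]
    by (simp add: o_def boundary_def)
  ultimately show "linear (\<lambda>p. (- 1) ^ k *\<^sub>R ext_deriv M (contract_along v p \<alpha>) - contract_along v (boundary br p) \<alpha>)"
    by (intro linear_compose_sub linear_compose_scale_right)
  show "linear (\<lambda>p. contract_along v p (ext_deriv M \<alpha>))"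
    by (rule linear_contract_along [OF d\<alpha>])
  show "p \<in> span {wedge xs | xs. length xs = k}"
    using p by (simp add: ext_power_def)
  show "contract_along v q (ext_deriv M \<alpha>) =
    (- 1) ^ k *\<^sub>R ext_deriv M (contract_along v q \<alpha>) - contract_along v (boundary br q) \<alpha>"
    if q: "q \<in> {wedge xs | xs. length xs = k}" for q
  proof -
    obtain xs where xs: "q = wedge xs" "length xs = k"
      using q by auto
    have "fold contract (map v xs) (ext_deriv M \<alpha>) =
        (- 1) ^ length (map v xs) *\<^sub>R ext_deriv M (fold contract (map v xs) \<alpha>)
        - bracket_contraction (map v xs) \<alpha>"
      by (rule ext_deriv_contractions [OF M \<alpha> v_list]) (use inv in auto)
    then show ?thesis
      by (simp only: xs length_map contract_along_wedge [OF \<alpha>] contract_along_wedge [OF d\<alpha>]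
          contract_along_boundary_wedge [OF \<alpha> br hom])
  qed
qed

end


section \<open>Conserved quantities from cycles\<close>

theorem proposition2p21:
  fixes M :: "'m::{t2_space, second_countable_topology} manifold"
    and n k :: nat
    and \<omega> H :: "'m form"
    and br :: "'g::real_vector \<Rightarrow> 'g \<Rightarrow> 'g"
    and v :: "'g \<Rightarrow> 'm vfield"
    and f :: "nat \<Rightarrow> 'g exterior \<Rightarrow> 'm form"
    and v_H :: "'m vfield"
    and p :: "'g exterior"
  assumes "pre_plectic M n \<omega>"
    and "H \<in> hamiltonian_forms M n \<omega>"
    and "lie_algebra br"
    and "multisymplectic_action M \<omega> br v"
    and "comomentum_map M n \<omega> br v f"
    and "strictly_preserves M v H"
    and "hamiltonian_vf M \<omega> H v_H"
    and "1 \<le> k" and "k \<le> n"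
    and "p \<in> cycles br k"
  shows "f k p \<in> forms M (n - k) \<and> globally_conserved M v_H (n - k) (f k p)"
proof
  have M: "smooth_manifold M" and \<omega>: "\<omega> \<in> forms M (n + 1)"
    using assms(1) by (auto simp: pre_plectic_def)
  have v: "\<And>x. v x \<in> vector_fields M" and linear_v: "linear v"
    and hom: "\<And>x y. v (br x y) = vf_bracket (v x) (v y)"
    using assms(4) by (auto simp: multisymplectic_action_def multisymplectic_fields_def)
  have H: "H \<in> forms M (n - 1)"
    using assms(2) by (simp add: hamiltonian_forms_def)
  have v_H: "v_H \<in> vector_fields M" and dH: "ext_deriv M H = - contract v_H \<omega>"
    using assms(7) by (auto simp: hamiltonian_vf_def)
  have inv: "\<And>x. lie_deriv M (v x) H = 0"
    using assms(6) by (simp add: strictly_preserves_def)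
  have p: "p \<in> ext_power k" and cycle: "boundary br p = 0"
    using assms(10) by (auto simp: cycles_def)
  note \<omega>_H = contract_forms [OF M \<omega> v_H]
  have dH_form: "ext_deriv M H \<in> forms M n"
    using subspace_neg [OF subspace_forms [OF M] \<omega>_H] by (simp add: dH)
  show F: "f k p \<in> forms M (n - k)"
  proof -
    have "f k ` ext_power k \<subseteq> forms M (n - k)"
      using assms(5,8,9) by (simp add: comomentum_map_def)
    then show ?thesis
      using p by blast
  qed

  \<comment> \<open>The convention \<open>f\<^sub>0 = 0\<close> enters for \<open>k = 1\<close>.\<close>
  let ?f = "\<lambda>i. if i \<in> {1..n} then f i else 0"
  have "?f (k - 1) 0 = 0"
  proof (cases "k - 1 \<in> {1..n}")
    case True
    then have "linear_on_subspace (ext_power (k - 1)) (f (k - 1))"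
      using assms(5) by (simp add: comomentum_map_def)
    moreover have "0 \<in> ext_power (k - 1)"
      by (simp add: ext_power_def span_zero)
    ultimately have "f (k - 1) (0 *\<^sub>R 0) = 0 *\<^sub>R f (k - 1) 0"
      unfolding linear_on_subspace_def by blast
    then show ?thesis
      by simp
  qed auto
  moreover have "- ?f (k - 1) (boundary br p) =
      ext_deriv M (?f k p) + varsigma k *\<^sub>R contract_along v p \<omega>"
    using assms(5,8,9) p unfolding comomentum_map_def Let_def by auto
  ultimately have dF: "ext_deriv M (f k p) = - varsigma k *\<^sub>R contract_along v p \<omega>"
    using assms(8,9) by (simp add: cycle eq_neg_iff_add_eq_0)

  let ?\<gamma> = "contract v_H (f k p) + varsigma k *\<^sub>R contract_along v p H"
  have "contract_along v p (contract v_H \<omega>) = - contract_along v p (ext_deriv M H)"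
    by (simp add: dH contract_along_uminus)
  also have "\<dots> = - ((- 1) ^ k *\<^sub>R ext_deriv M (contract_along v p H))"
    using contract_along_ext_deriv [OF M linear_v v H dH_form assms(3) hom inv p]
      linear_0 [OF linear_contract_along [OF M linear_v v H]] by (simp add: cycle)
  finally have "contract v_H (ext_deriv M (f k p)) = varsigma k *\<^sub>R ext_deriv M (contract_along v p H)"
    by (simp add: dF linear_neg [OF linear_contract] contract_linear
      contract_contract_along [OF M linear_v v \<omega> v_H p] flip: scaleR_minus_left)
  moreover have iF: "contract v_H (f k p) \<in> forms M (n - k - 1)"
    by (rule contract_forms [OF M F v_H])
  moreover have iH: "contract_along v p H \<in> forms M (n - k - 1)"
    using contract_along_forms [OF M linear_v v H p] by (simp add: diff_commute)
  ultimately have L: "lie_deriv M v_H (f k p) = ext_deriv M ?\<gamma>"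
    using Cartan_formula [OF M F v_H] forms_smooth [OF M]
    by (simp add: ext_deriv_linear_combination [OF M])
  show "globally_conserved M v_H (n - k) (f k p)"
  proof (cases "n - k")
    case 0
    then have "n - 1 < k"
      using assms(8,9) by simp
    then have "contract_along v p H = 0"
      by (rule contract_along_degree [OF M linear_v v H p])
    moreover have "contract v_H (f k p) = 0"
      using F 0 by (auto simp: contract_def fun_eq_iff forms_outside)
    moreover have "ext_deriv M 0 = 0"
      using ext_deriv_linear_combination [OF M, of 0 0 1] smooth_0 [OF M] by simp
    ultimately show ?thesis
      using L 0 by (simp add: globally_conserved_def exact_form_def)
  next
    case (Suc j)
    have "?\<gamma> \<in> forms M j"
      using subspace_add [OF subspace_forms [OF M] iF subspace_scale [OF subspace_forms [OF M] iH]] Suc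
      by simp
    then show ?thesis
      unfolding globally_conserved_def exact_form_def using L Suc by auto
  qed
qed

end
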